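(* Let $q$ be a prime with $q\equiv 3 \pmod 4$ and let $S=\{2,q\}$. Then there is no $S$-Diophantine quadruple.
   Context: For a finite set $S$ of primes, a positive integer is an $S$-unit if all its prime factors lie in $S$. An $m$-tuple $(a_1,\ldots,a_m)$ of positive, pairwise distinct integers is called an $S$-Diophantine $m$-tuple if $a_ia_j+1$ is an $S$-unit for all $i\neq j$. An $S$-Diophantine quadruple is the case $m=4$. *)

theory Defs
  imports "HOL-Number_Theory.Number_Theory"
begin

definition S_unit :: "nat set \<Rightarrow> nat \<Rightarrow> bool" where
  "S_unit S n \<longleftrightarrow> n > 0 \<and> prime_factors n \<subseteq> S"

definition S_diophantine_tuple :: "nat set \<Rightarrow> nat \<Rightarrow> nat list \<Rightarrow> bool" where
  "S_diophantine_tuple S m xs \<longleftrightarrow>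
     length xs = m \<and> (\<forall>x\<in>set xs. x > 0) \<and> distinct xs \<and>
     (\<forall>i<m. \<forall>j<m. i \<noteq> j \<longrightarrow> S_unit S (xs ! i * xs ! j + 1))"

abbreviation S_diophantine_quadruple :: "nat set \<Rightarrow> nat list \<Rightarrow> bool" where
  "S_diophantine_quadruple S \<equiv> S_diophantine_tuple S 4"

end

theory Submission
  imports Defs
begin

text \<open>
  Since \<open>- 1\<close> is a square neither modulo \<open>4\<close> nor modulo \<open>q\<close>, the three values \<open>rs + 1\<close>, \<open>rt + 1\<close>,
  \<open>st + 1\<close> of a triple are never all divisible by \<open>4\<close>, nor all divisible by \<open>q\<close>. Hence all members
  of a quadruple are odd, and viewing pairs as edges of \<open>K\<^sub>4\<close>, the edges not divisible by \<open>4\<close> and those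
  not divisible by \<open>q\<close> each contain a perfect matching. So, with \<open>c = p = 2\<close>, the quadruple can be
  named such that \<open>xy + 1 = cq\<^sup>e\<close>, \<open>zw + 1 = cq\<^sup>f\<close>, \<open>xz + 1 = cp\<^sup>g\<close>, \<open>yw + 1 = cp\<^sup>h\<close>,
  \<open>xw + 1 = cp\<^sup>i q\<^sup>j\<close>, \<open>yz + 1 = cp\<^sup>k q\<^sup>l\<close> with \<open>x\<close> maximal. This shape is invariant under exchanging
  \<open>y\<close> with \<open>z\<close> and \<open>p\<close> with \<open>q\<close>.

  A common divisor of \<open>ab + 1\<close> and \<open>ac + 1\<close> divides \<open>b - c\<close>. By maximality of \<open>x\<close> this gives \<open>j < e\<close>
  and \<open>i < g\<close>, so \<open>cq\<^sup>j\<close> divides \<open>y - w\<close> and \<open>cp\<^sup>i\<close> divides \<open>z - w\<close>. The product of these differences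
  is therefore at least \<open>c(xw + 1)\<close>, which forces \<open>w < y\<close>, \<open>w < z\<close> and \<open>xw < yz\<close>. Comparing the
  valuations of \<open>xyzw - 1\<close>, \<open>j \<noteq> l\<close> implies \<open>f \<le> l\<close>, so that \<open>zw + 1\<close> divides \<open>yz + 1\<close> and
  \<open>z < y\<close>, while \<open>i \<noteq> k\<close> similarly implies \<open>y < z\<close>. So \<open>j = l\<close> or \<open>i = k\<close>, and a size estimate
  excludes each of them.
\<close>

section \<open>Divisors of products plus one\<close>

lemma dvd_diff_if_dvd_mult_plus_one:
  fixes a b c d :: "'a::comm_ring_1"
  assumes "d dvd a * b + 1" "d dvd a * c + 1"
  shows "d dvd b - c"
proof -
  have "d dvd b * (a * c + 1) - c * (a * b + 1)"
    using assms by (intro dvd_diff dvd_mult)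
  then show ?thesis
    by (simp add: algebra_simps)
qed

lemma less_if_mult_plus_one_dvd:
  fixes a b c :: int
  assumes "a > 0" "b > 0" "c > 0" "b \<noteq> c" and dvd: "a * b + 1 dvd a * c + 1"
  shows "a < c" "b < c"
proof -
  have "a * b + 1 dvd c - b"
    using dvd by (intro dvd_diff_if_dvd_mult_plus_one[of _ a]) auto
  then have "a * b + 1 \<le> \<bar>c - b\<bar>"
    using \<open>b \<noteq> c\<close> by (intro zdvd_imp_le) auto
  moreover have "a \<le> a * b" "b \<le> a * b"
    using \<open>a > 0\<close> \<open>b > 0\<close> by (simp_all add: mult_le_cancel_left1 mult_le_cancel_right1)
  ultimately show "a < c" "b < c"
    using assms(1-3) by - linarith+
qed

lemma not_power_Suc_dvd_add:
  fixes p u v :: "'a::idom"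
  assumes "p \<noteq> 0" "a < b" "\<not> p dvd u"
  shows "\<not> p ^ Suc a dvd p ^ a * u + p ^ b * v"
proof
  assume dvd: "p ^ Suc a dvd p ^ a * u + p ^ b * v"
  have "p ^ Suc a dvd p ^ b * v"
    using \<open>a < b\<close> by (intro dvd_mult2 le_imp_power_dvd) simp
  with dvd have "p ^ a * p dvd p ^ a * u"
    by (simp only: dvd_add_left_iff power_Suc2)
  with \<open>p \<noteq> 0\<close> \<open>\<not> p dvd u\<close> show False
    by simp
qed

section \<open>Quadruples with prescribed shape\<close>

locale power_quadruple =
  fixes c p q x y z w :: int and e f g h i j k l :: nat
  assumes c_pos: "c > 0" and p_gt_1: "p > 1" and q_gt_1: "q > 1" and coprime: "coprime p q"
    and pos: "x > 0" "y > 0" "z > 0" "w > 0" and distinct: "distinct [x, y, z, w]"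
    and xy: "x * y + 1 = c * q ^ e" and zw: "z * w + 1 = c * q ^ f"
    and xz: "x * z + 1 = c * p ^ g" and yw: "y * w + 1 = c * p ^ h"
    and xw: "x * w + 1 = c * p ^ i * q ^ j" and yz: "y * z + 1 = c * p ^ k * q ^ l"
begin

lemma swap_xy_zw: "power_quadruple c p q y x w z e f h g k l i j"
  using c_pos p_gt_1 q_gt_1 coprime pos distinct xy zw xz yw xw yz
  by unfold_locales (auto simp: mult.commute)

lemma swap_xz_yw: "power_quadruple c p q z w x y f e g h k l i j"
  using c_pos p_gt_1 q_gt_1 coprime pos distinct xy zw xz yw xw yz
  by unfold_locales (auto simp: mult.commute)

lemma swap_bases: "power_quadruple c q p x z y w g h e f j i l k"
  using c_pos p_gt_1 q_gt_1 coprime pos distinct xy zw xz yw xw yz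
  by unfold_locales (auto simp: ac_simps)

lemma q_not_dvd_p_power: "\<not> q dvd p ^ n"
proof
  assume "q dvd p ^ n"
  moreover have "coprime (p ^ n) q"
    using coprime by simp
  ultimately have "is_unit q"
    using coprime_common_divisor[of "p ^ n" q q] by simp
  then show False
    using q_gt_1 by simp
qed

lemma power_sum_eq:
  "q ^ e + q ^ f - c * q ^ (e + f) = p ^ i * q ^ j + p ^ k * q ^ l - c * p ^ (i + k) * q ^ (j + l)"
proof -
  have "(c * q ^ e - 1) * (c * q ^ f - 1) = (c * p ^ i * q ^ j - 1) * (c * p ^ k * q ^ l - 1)"
    by (simp flip: xy zw xw yz)
  then have "c * (q ^ e + q ^ f - c * q ^ (e + f))
      = c * (p ^ i * q ^ j + p ^ k * q ^ l - c * p ^ (i + k) * q ^ (j + l))"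
    by (simp add: algebra_simps power_add)
  then show ?thesis
    using c_pos by simp
qed

end

lemma not_dvd_mult_plus_one_if_large_diff:
  fixes w x y z P D :: int
  assumes pos: "w > 0" "z > 0" "P > 0" "D > 0"
    and xw: "x * w + 1 = P * (z * w + 1)" and yz: "y * z + 1 = P * D * (z * w + 1)"
    and "P \<le> z" "z < x" and dvd: "(z * w + 1) * D dvd x - z"
  shows "\<not> P dvd y * w + 1"
proof
  assume "P dvd y * w + 1"
  have "(z * w + 1) * D \<le> x - z"
    using dvd \<open>z < x\<close> by (intro zdvd_imp_le) auto
  then have "w * ((z * w + 1) * D) \<le> w * (x - z)"
    using pos by simp
  also have "w * (x - z) = (z * w + 1) * (P - 1)"
    using xw by (simp add: algebra_simps)
  finally have "(z * w + 1) * (w * D) \<le> (z * w + 1) * (P - 1)"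
    by (simp add: mult_ac)
  moreover have "0 < z * w + 1"
    using pos by (simp add: add_pos_pos)
  ultimately have wD: "w * D \<le> P - 1"
    using mult_le_cancel_left_pos by blast
  \<comment> \<open>This \<open>v\<close> is positive with \<open>P dvd vw + 1\<close>, yet too small for that.\<close>
  define v where "v = y - P * D * w"
  have zv: "z * v = P * D - 1"
    using yz by (simp add: v_def algebra_simps)
  have "0 < w * D"
    using pos by simp
  then have "1 * 1 < P * D"
    using wD pos by (intro mult_less_le_imp_less) linarith+
  then have "v > 0"
    using zv pos zero_less_mult_pos[of z v] by linarith
  then have "P * v \<le> z * v"
    using \<open>P \<le> z\<close> by simp
  then have "P * v < P * D"
    using zv by linarith
  then have "w * v < w * D"
    using pos by simp
  then have "v * w + 1 < P"
    using wD by (simp add: mult.commute)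
  have "y * w + 1 = P * (D * w * w) + (v * w + 1)"
    by (simp add: v_def algebra_simps)
  then have "P dvd v * w + 1"
    using \<open>P dvd y * w + 1\<close> by (metis dvd_add_right_iff dvd_triv_left)
  then have "P \<le> v * w + 1"
    using \<open>v > 0\<close> pos by (intro zdvd_imp_le) (auto simp: add_pos_pos)
  then show False
    using \<open>v * w + 1 < P\<close> by simp
qed

locale max_power_quadruple = power_quadruple +
  assumes x_max: "y < x" "z < x" "w < x"

sublocale max_power_quadruple \<subseteq> dual: max_power_quadruple c q p x z y w g h e f j i l k
  by (intro max_power_quadruple.intro swap_bases max_power_quadruple_axioms.intro x_max)

lemma (in max_power_quadruple) j_less_e: "j < e"
proof (rule ccontr)
  assume "\<not> j < e"
  then have "x * y + 1 dvd x * w + 1"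
    unfolding xy xw by (intro mult_dvd_mono dvd_triv_left le_imp_power_dvd) simp
  then have "x < w"
    using less_if_mult_plus_one_dvd(1)[of x y w] pos distinct by simp
  then show False
    using x_max by simp
qed

lemma (in max_power_quadruple) l_less_e: "l < e"
proof (rule ccontr)
  assume "\<not> l < e"
  then have "y * x + 1 dvd y * z + 1"
    unfolding mult.commute[of y x] xy yz by (intro mult_dvd_mono dvd_triv_left le_imp_power_dvd) simp
  then have "x < z"
    using less_if_mult_plus_one_dvd(2)[of y x z] pos distinct by simp
  then show False
    using x_max by simp
qed

lemma (in max_power_quadruple) y_w_diff_ge: "c * q ^ j \<le> \<bar>y - w\<bar>"
proof -
  have "c * q ^ j dvd x * y + 1" "c * q ^ j dvd x * w + 1"
    using j_less_e by (simp_all add: xy xw le_imp_power_dvd)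
  then have "c * q ^ j dvd y - w"
    by (rule dvd_diff_if_dvd_mult_plus_one)
  then show ?thesis
    using distinct by (intro zdvd_imp_le) auto
qed

lemma (in max_power_quadruple) diff_product_ge: "x * w < \<bar>y - w\<bar> * \<bar>z - w\<bar>"
proof -
  have "x * w + 1 \<le> c * (x * w + 1)"
    using mult_right_mono[of 1 c "x * w + 1"] c_pos pos by simp
  also have "\<dots> = (c * q ^ j) * (c * p ^ i)"
    unfolding xw by simp
  also have "\<dots> \<le> \<bar>y - w\<bar> * \<bar>z - w\<bar>"
    using y_w_diff_ge dual.y_w_diff_ge c_pos p_gt_1 by (intro mult_mono) auto
  finally show ?thesis
    by simp
qed

lemma (in max_power_quadruple) w_less_y: "w < y"
proof (rule ccontr)
  assume "\<not> w < y"
  then have "\<bar>y - w\<bar> * \<bar>z - w\<bar> \<le> w * x"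
    using pos x_max by (intro mult_mono) auto
  then show False
    using diff_product_ge by (simp add: mult.commute)
qed

lemma (in max_power_quadruple) xw_less_yz: "x * w < y * z"
proof -
  have "\<bar>y - w\<bar> * \<bar>z - w\<bar> \<le> y * z"
    using w_less_y dual.w_less_y pos by (intro mult_mono) auto
  then show ?thesis
    using diff_product_ge by simp
qed

lemma (in max_power_quadruple) min_j_l_le_f: "min j l \<le> f"
proof (rule ccontr)
  assume "\<not> min j l \<le> f"
  then have "Suc f \<le> j" "Suc f \<le> l" "f < e"
    using j_less_e by auto
  then have "q ^ Suc f dvd p ^ i * q ^ j + p ^ k * q ^ l - c * p ^ (i + k) * q ^ (j + l)
      + c * q ^ (e + f)"
    by (intro dvd_add dvd_diff dvd_mult le_imp_power_dvd) auto
  also have "\<dots> = q ^ f * 1 + q ^ e * 1"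
    by (simp flip: power_sum_eq)
  finally show False
    using not_power_Suc_dvd_add[of q f e 1 1] \<open>f < e\<close> q_gt_1 by simp
qed

lemma (in max_power_quadruple) f_le_min_j_l:
  assumes "j \<noteq> l"
  shows "f \<le> min j l"
proof (rule ccontr)
  assume "\<not> f \<le> min j l"
  then have "Suc (min j l) \<le> f" "Suc (min j l) \<le> e" "Suc (min j l) \<le> j + l"
    using j_less_e \<open>j \<noteq> l\<close> by auto
  then have "q ^ Suc (min j l) dvd q ^ e + q ^ f - c * q ^ (e + f) + c * p ^ (i + k) * q ^ (j + l)"
    by (intro dvd_add dvd_diff dvd_mult le_imp_power_dvd) auto
  also have "\<dots> = q ^ j * p ^ i + q ^ l * p ^ k"
    by (simp add: power_sum_eq mult.commute)
  finally have dvd: "q ^ Suc (min j l) dvd q ^ j * p ^ i + q ^ l * p ^ k" .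
  show False
    using dvd not_power_Suc_dvd_add[OF _ _ q_not_dvd_p_power, of j l i "p ^ k"]
      not_power_Suc_dvd_add[OF _ _ q_not_dvd_p_power, of l j k "p ^ i"] \<open>j \<noteq> l\<close> q_gt_1
    by (cases "j < l") (auto simp: add.commute)
qed

lemma (in max_power_quadruple) z_less_y_if_j_neq_l:
  assumes "j \<noteq> l"
  shows "z < y"
proof -
  have "z * w + 1 dvd z * y + 1"
    unfolding mult.commute[of z y] zw yz
    using f_le_min_j_l[OF assms] by (intro mult_dvd_mono dvd_triv_left le_imp_power_dvd) simp
  then show ?thesis
    using less_if_mult_plus_one_dvd(1)[of z w y] pos distinct by simp
qed

lemma (in max_power_quadruple) i_neq_k: "i \<noteq> k"
proof
  assume "i = k"
  have "c * p ^ i * q ^ j < c * p ^ i * q ^ l"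
    using xw_less_yz xw yz \<open>i = k\<close> by simp
  then have "j < l"
    using c_pos p_gt_1 q_gt_1 by simp
  then have "f = j"
    using min_j_l_le_f f_le_min_j_l by simp
  have dvd: "c * q ^ l dvd y * x + 1" "c * q ^ l dvd y * z + 1"
    using l_less_e by (simp_all add: xy yz mult.commute[of y x] le_imp_power_dvd)
  have "p ^ i \<le> c * p ^ i"
    using c_pos p_gt_1 by simp
  also have "\<dots> \<le> \<bar>z - w\<bar>"
    by (rule dual.y_w_diff_ge)
  also have "\<dots> \<le> z"
    using dual.w_less_y pos by simp
  finally have "p ^ i \<le> z" .
  have q_l: "q ^ l = q ^ j * q ^ (l - j)"
    using \<open>j < l\<close> by (simp flip: power_add)
  have "\<not> p ^ i dvd y * w + 1"
  proof (rule not_dvd_mult_plus_one_if_large_diff)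
    show "(z * w + 1) * q ^ (l - j) dvd x - z"
      using dvd_diff_if_dvd_mult_plus_one[OF dvd] by (simp add: zw q_l \<open>f = j\<close> mult.assoc)
    show "y * z + 1 = p ^ i * q ^ (l - j) * (z * w + 1)"
      unfolding yz zw by (simp add: q_l \<open>f = j\<close> \<open>i = k\<close>)
    show "x * w + 1 = p ^ i * (z * w + 1)"
      unfolding xw zw by (simp add: \<open>f = j\<close>)
  qed (use pos p_gt_1 q_gt_1 x_max \<open>p ^ i \<le> z\<close> in auto)
  moreover have "p ^ i dvd y * w + 1"
    unfolding yw using dual.min_j_l_le_f \<open>i = k\<close> by (simp add: le_imp_power_dvd)
  ultimately show False
    by blast
qed

lemma no_max_power_quadruple: "\<not> max_power_quadruple c p q x y z w e f g h i j k l"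
proof
  assume "max_power_quadruple c p q x y z w e f g h i j k l"
  then interpret max_power_quadruple c p q x y z w e f g h i j k l .
  show False
    using z_less_y_if_j_neq_l[OF dual.i_neq_k] dual.z_less_y_if_j_neq_l[OF i_neq_k] by simp
qed

lemma no_power_quadruple: "\<not> power_quadruple c p q x y z w e f g h i j k l"
proof
  assume quad: "power_quadruple c p q x y z w e f g h i j k l"
  have not_max: "\<not> (y < x \<and> z < x \<and> w < x)"
    if "power_quadruple c p q x y z w e f g h i j k l" for x y z w e f g h i j k l
    using that no_max_power_quadruple[of c p q x y z w e f g h i j k l]
    by (simp add: max_power_quadruple_def max_power_quadruple_axioms_def)
  note swap_xy = power_quadruple.swap_xy_zw and swap_xz = power_quadruple.swap_xz_yw
  consider "y < x" "z < x" "w < x" | "x < y" "z < y" "w < y"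
    | "x < z" "y < z" "w < z" | "x < w" "y < w" "z < w"
    using power_quadruple.distinct[OF quad] by (auto simp: neq_iff)
  then show False
    using not_max[OF quad] not_max[OF swap_xy[OF quad]] not_max[OF swap_xz[OF quad]]
      not_max[OF swap_xy[OF swap_xz[OF quad]]]
    by cases blast+
qed

section \<open>Square roots of minus one\<close>

lemma not_QuadRes_minus_one_prime:
  fixes q :: nat
  assumes "prime q" "[q = 3] (mod 4)"
  shows "\<not> QuadRes (int q) (- 1)"
proof
  assume "QuadRes (int q) (- 1)"
  have "q mod 4 = 3"
    using assms(2) by (simp add: cong_def)
  then have "q > 2" "odd ((q - 1) div 2)"
    by presburger+
  have "\<not> [- 1 = 0] (mod int q)"
    using \<open>q > 2\<close> by (simp add: cong_0_iff)
  then have "Legendre (- 1) (int q) = 1"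
    using \<open>QuadRes (int q) (- 1)\<close> by (simp add: Legendre_def)
  then have "[1 = - 1] (mod int q)"
    using euler_criterion[OF \<open>prime q\<close> \<open>q > 2\<close>, of "- 1"] \<open>odd ((q - 1) div 2)\<close> by simp
  then have "int q dvd 2"
    by (simp add: cong_iff_dvd_diff)
  then show False
    using \<open>q > 2\<close> zdvd_imp_le[of "int q" 2] by simp
qed

lemma not_QuadRes_minus_one_four: "\<not> QuadRes 4 (- 1)"
proof
  assume "QuadRes 4 (- 1)"
  then obtain n :: int where "n ^ 2 mod 4 = 3"
    by (auto simp: QuadRes_def cong_def)
  moreover have "n ^ 2 mod 4 = (n mod 4) ^ 2 mod 4"
    by (simp add: power_mod)
  moreover have "n mod 4 \<in> {0, 1, 2, 3}"
    by auto
  ultimately show False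
    by auto
qed

lemma not_all_dvd_mult_plus_one:
  assumes "\<not> QuadRes m (- 1)"
  shows "\<not> (m dvd r * s + 1 \<and> m dvd r * t + 1 \<and> m dvd s * t + 1)"
proof
  assume "m dvd r * s + 1 \<and> m dvd r * t + 1 \<and> m dvd s * t + 1"
  then have "[r * s = - 1] (mod m)" "[r * t = - 1] (mod m)" "[s * t = - 1] (mod m)"
    by (simp_all add: cong_iff_dvd_diff)
  then have "[(r * s) * (r * t) * (s * t) = (- 1) * (- 1) * (- 1)] (mod m)"
    by (intro cong_mult)
  then have "[(r * s * t) ^ 2 = - 1] (mod m)"
    by (simp add: power2_eq_square mult_ac)
  then show False
    using assms by (auto simp: QuadRes_def)
qed

section \<open>Matchings in the complete graph on four vertices\<close>

lemma no_monochromatic_triangle_imp_perfect_matching: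
  assumes "X = {a, b, c, d}" "distinct [a, b, c, d]"
    and triangle: "\<And>r s t. {r, s, t} \<subseteq> X \<Longrightarrow> distinct [r, s, t] \<Longrightarrow>
      (T r s \<or> T r t \<or> T s t) \<and> \<not> (T r s \<and> T r t \<and> T s t)"
  shows "T a b \<and> T c d \<or> T a c \<and> T b d \<or> T a d \<and> T b c"
  using assms(1,2) triangle[of a b c] triangle[of a b d] triangle[of a c d] triangle[of b c d]
  by auto

lemma obtain_alternating_4_cycle:
  assumes "card X = 4" and "symp T"
    and triangle_T: "\<And>r s t. T r s \<or> T r t \<or> T s t"
    and triangle_U: "\<And>r s t. U r s \<or> U r t \<or> U s t"
    and disjoint: "\<And>r s. r \<in> X \<Longrightarrow> s \<in> X \<Longrightarrow> r \<noteq> s \<Longrightarrow> \<not> (T r s \<and> U r s)"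
  obtains x y z w where "X = {x, y, z, w}" "distinct [x, y, z, w]" "T x y" "T z w" "U x z" "U y w"
proof -
  have not_monochromatic: "(T r s \<or> T r t \<or> T s t) \<and> \<not> (T r s \<and> T r t \<and> T s t)"
    "(U r s \<or> U r t \<or> U s t) \<and> \<not> (U r s \<and> U r t \<and> U s t)"
    if "{r, s, t} \<subseteq> X" "distinct [r, s, t]" for r s t
    using that triangle_T[of r s t] triangle_U[of r s t] disjoint[of r s] disjoint[of r t]
      disjoint[of s t] by auto
  obtain a b c d where abcd: "X = {a, b, c, d}" "distinct [a, b, c, d]"
    using \<open>card X = 4\<close> by (auto simp: card_Suc_eq numeral_eq_Suc)
  then have "T a b \<and> T c d \<or> T a c \<and> T b d \<or> T a d \<and> T b c"
    using not_monochromatic(1) by (rule no_monochromatic_triangle_imp_perfect_matching)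
  moreover have "X = {a, c, b, d}" "X = {a, d, b, c}" "distinct [a, c, b, d]" "distinct [a, d, b, c]"
    using abcd by auto
  ultimately obtain x y z w where X: "X = {x, y, z, w}" and dist: "distinct [x, y, z, w]"
    and T: "T x y" "T z w"
    using abcd by blast
  have "U x y \<and> U z w \<or> U x z \<and> U y w \<or> U x w \<and> U y z"
    using X dist not_monochromatic(2) by (rule no_monochromatic_triangle_imp_perfect_matching)
  moreover have "\<not> U x y"
    using disjoint[of x y] X dist T by simp
  ultimately consider "U x z" "U y w" | "U x w" "U y z"
    by blast
  then show thesis
  proof cases
    case 1
    with X dist T show thesis
      by (rule that)
  next
    case 2
    moreover have "X = {x, y, w, z}" "distinct [x, y, w, z]"
      using X dist by auto
    moreover have "T w z"
      using \<open>symp T\<close> \<open>T z w\<close> by (rule sympD)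
    ultimately show thesis
      using that \<open>T x y\<close> by blast
  qed
qed

section \<open>S-units\<close>

lemma S_unit_eq_prod:
  assumes "finite S" "\<And>p. p \<in> S \<Longrightarrow> prime p" "S_unit S n"
  shows "n = (\<Prod>p\<in>S. p ^ multiplicity p n)"
proof -
  have "n > 0" "prime_factors n \<subseteq> S"
    using \<open>S_unit S n\<close> by (auto simp: S_unit_def)
  have "n = (\<Prod>p\<in>prime_factors n. p ^ multiplicity p n)"
    using \<open>n > 0\<close> by (rule prime_factorization_nat)
  also have "\<dots> = (\<Prod>p\<in>S. p ^ multiplicity p n)"
    using assms(1,2) \<open>prime_factors n \<subseteq> S\<close>
    by (intro prod.mono_neutral_left) (auto simp: prime_factors_multiplicity)
  finally show ?thesis .
qed

lemma S_diophantine_tuple_imp_S_unit: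
  assumes "S_diophantine_tuple S m xs" "r \<in> set xs" "s \<in> set xs" "r \<noteq> s"
  shows "S_unit S (r * s + 1)"
  using assms unfolding S_diophantine_tuple_def by (metis in_set_conv_nth)

section \<open>Quadruples for two primes\<close>

locale two_prime_quadruple =
  fixes q :: int and X :: "int set"
  assumes prime_q: "prime q" and odd_q: "odd q" and not_QuadRes: "\<not> QuadRes q (- 1)"
    and card: "card X = 4" and pos: "\<And>r. r \<in> X \<Longrightarrow> r > 0"
    and mult_plus_one_eq: "\<And>r s. r \<in> X \<Longrightarrow> s \<in> X \<Longrightarrow> r \<noteq> s \<Longrightarrow> \<exists>m n. r * s + 1 = 2 ^ m * q ^ n"
begin

lemma product_ge_2:
  assumes "r \<in> X" "s \<in> X" "r \<noteq> s"
  shows "r * s \<ge> 2"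
proof -
  have "r * s > 0" "r * s \<noteq> 1"
    using assms pos by (auto simp: pos_zmult_eq_1_iff)
  then show ?thesis
    by simp
qed

lemma four_dvd_if_not_q_dvd:
  assumes rs: "r \<in> X" "s \<in> X" "r \<noteq> s" and "\<not> q dvd r * s + 1"
  shows "4 dvd r * s + 1"
proof -
  obtain m n where mn: "r * s + 1 = 2 ^ m * q ^ n"
    using mult_plus_one_eq rs by blast
  with \<open>\<not> q dvd r * s + 1\<close> have "n = 0"
    by (cases n) auto
  with mn have m: "r * s + 1 = 2 ^ m"
    by simp
  with product_ge_2[OF rs] have "2 ^ 1 < (2::int) ^ m"
    by simp
  then have "2 \<le> m"
    by (simp only: power_strict_increasing_iff)
  then have "(2::int) ^ 2 dvd 2 ^ m"
    by (rule le_imp_power_dvd)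
  then show ?thesis
    by (simp add: m)
qed

lemma odd_member:
  assumes "r \<in> X"
  shows "odd r"
proof
  assume "even r"
  have q_dvd: "q dvd r * s + 1" if "s \<in> X - {r}" for s
  proof (rule ccontr)
    assume "\<not> q dvd r * s + 1"
    then have "4 dvd r * s + 1"
      using four_dvd_if_not_q_dvd assms that by auto
    then have "even (r * s + 1)"
      by (meson dvd_trans even_numeral)
    then show False
      using \<open>even r\<close> by simp
  qed
  have four_dvd: "4 dvd s * t + 1" if "s \<in> X - {r}" "t \<in> X - {r}" "s \<noteq> t" for s t
    using that q_dvd not_all_dvd_mult_plus_one[OF not_QuadRes, of r s t] four_dvd_if_not_q_dvd
    by blast
  have "card (X - {r}) = 3"
    using card assms by simp
  then obtain s t u where "X - {r} = {s, t, u}" "s \<noteq> t" "s \<noteq> u" "t \<noteq> u"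
    by (auto simp: card_3_iff)
  then show False
    using four_dvd not_all_dvd_mult_plus_one[OF not_QuadRes_minus_one_four, of s t u] by simp
qed

lemma mult_plus_one_eq_even:
  assumes rs: "r \<in> X" "s \<in> X" "r \<noteq> s"
  obtains m n where "r * s + 1 = 2 * 2 ^ m * q ^ n"
proof -
  obtain m n where mn: "r * s + 1 = 2 ^ m * q ^ n"
    using mult_plus_one_eq rs by blast
  have "even (r * s + 1)"
    using odd_member rs by simp
  with mn odd_q have "m > 0"
    by (auto intro: Nat.gr0I)
  with mn have "r * s + 1 = 2 * 2 ^ (m - 1) * q ^ n"
    by (simp flip: power_Suc)
  then show thesis
    by (rule that)
qed

lemma mult_plus_one_eq_if_not_q_dvd:
  assumes "r \<in> X" "s \<in> X" "r \<noteq> s" "\<not> q dvd r * s + 1"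
  obtains m where "r * s + 1 = 2 * 2 ^ m"
proof -
  obtain m n where mn: "r * s + 1 = 2 * 2 ^ m * q ^ n"
    using mult_plus_one_eq_even assms by blast
  with \<open>\<not> q dvd r * s + 1\<close> have "n = 0"
    by (cases n) auto
  with mn that show thesis
    by simp
qed

lemma mult_plus_one_eq_if_not_4_dvd:
  assumes "r \<in> X" "s \<in> X" "r \<noteq> s" "\<not> 4 dvd r * s + 1"
  obtains n where "r * s + 1 = 2 * q ^ n"
proof -
  obtain m n where mn: "r * s + 1 = 2 * 2 ^ m * q ^ n"
    using mult_plus_one_eq_even assms by blast
  have "m = 0"
  proof (rule ccontr)
    assume "m \<noteq> 0"
    then have "2 * 2 dvd 2 * (2::int) ^ m"
      by (intro mult_dvd_mono) auto
    with mn \<open>\<not> 4 dvd r * s + 1\<close> show False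
      by simp
  qed
  with mn that show thesis
    by simp
qed

lemma obtain_power_quadruple:
  obtains x y z w e f g h i j k l where "power_quadruple 2 2 q x y z w e f g h i j k l"
proof -
  define T U where "T r s \<longleftrightarrow> \<not> 4 dvd r * s + 1" and "U r s \<longleftrightarrow> \<not> q dvd r * s + 1" for r s :: int
  have sym: "symp T"
    by (simp add: symp_def T_def mult.commute)
  have triangle: "T r s \<or> T r t \<or> T s t" "U r s \<or> U r t \<or> U s t" for r s t
    using not_all_dvd_mult_plus_one[OF not_QuadRes_minus_one_four, of r s t]
      not_all_dvd_mult_plus_one[OF not_QuadRes, of r s t] by (auto simp: T_def U_def)
  have disjoint: "\<not> (T r s \<and> U r s)" if "r \<in> X" "s \<in> X" "r \<noteq> s" for r s
    using that four_dvd_if_not_q_dvd by (auto simp: T_def U_def)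
  obtain x y z w where X: "X = {x, y, z, w}" and dist: "distinct [x, y, z, w]"
    and cycle: "T x y" "T z w" "U x z" "U y w"
    by (rule obtain_alternating_4_cycle[OF card sym triangle disjoint])
  obtain e where "x * y + 1 = 2 * q ^ e"
    using mult_plus_one_eq_if_not_4_dvd[of x y] X dist cycle by (auto simp: T_def)
  moreover obtain f where "z * w + 1 = 2 * q ^ f"
    using mult_plus_one_eq_if_not_4_dvd[of z w] X dist cycle by (auto simp: T_def)
  moreover obtain g where "x * z + 1 = 2 * 2 ^ g"
    using mult_plus_one_eq_if_not_q_dvd[of x z] X dist cycle by (auto simp: U_def)
  moreover obtain h where "y * w + 1 = 2 * 2 ^ h"
    using mult_plus_one_eq_if_not_q_dvd[of y w] X dist cycle by (auto simp: U_def)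
  moreover obtain i j where "x * w + 1 = 2 * 2 ^ i * q ^ j"
    using mult_plus_one_eq_even[of x w] X dist by auto
  moreover obtain k l where "y * z + 1 = 2 * 2 ^ k * q ^ l"
    using mult_plus_one_eq_even[of y z] X dist by auto
  ultimately have "power_quadruple 2 2 q x y z w e f g h i j k l"
    using prime_q odd_q pos X dist by unfold_locales (auto simp: prime_gt_1_int)
  then show thesis
    by (rule that)
qed

end

lemma S_diophantine_quadruple_imp_two_prime_quadruple:
  assumes q: "prime q" "odd q" "\<not> QuadRes (int q) (- 1)"
    and quad: "S_diophantine_quadruple {2, q} xs"
  shows "two_prime_quadruple (int q) (int ` set xs)"
proof
  show "prime (int q)" "odd (int q)" "\<not> QuadRes (int q) (- 1)"
    using q by simp_all
  show "card (int ` set xs) = 4"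
    using quad by (simp add: S_diophantine_tuple_def card_image distinct_card)
  show "r > 0" if "r \<in> int ` set xs" for r
    using that quad by (auto simp: S_diophantine_tuple_def)
  show "\<exists>m n. r * s + 1 = 2 ^ m * int q ^ n"
    if rs: "r \<in> int ` set xs" "s \<in> int ` set xs" "r \<noteq> s" for r s
  proof -
    obtain b c where bc: "b \<in> set xs" "c \<in> set xs" "r = int b" "s = int c"
      using rs by auto
    define a where "a = b * c + 1"
    have "S_unit {2, q} a"
      unfolding a_def using S_diophantine_tuple_imp_S_unit[OF quad] bc \<open>r \<noteq> s\<close> by blast
    then have "a = (\<Prod>p\<in>{2, q}. p ^ multiplicity p a)"
      using q by (intro S_unit_eq_prod) auto
    also have "\<dots> = 2 ^ multiplicity 2 a * q ^ multiplicity q a"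
      using \<open>odd q\<close> by (subst prod.insert) auto
    finally have "int a = 2 ^ multiplicity 2 a * int q ^ multiplicity q a"
      by (metis of_nat_mult of_nat_numeral of_nat_power)
    moreover have "int a = r * s + 1"
      by (simp add: a_def bc)
    ultimately show ?thesis
      by metis
  qed
qed

theorem theorem1:
  fixes q :: nat
  assumes "prime q" and "[q = 3] (mod 4)"
  shows "\<not> (\<exists>xs. S_diophantine_quadruple {2, q} xs)"
proof
  assume "\<exists>xs. S_diophantine_quadruple {2, q} xs"
  then obtain xs where "S_diophantine_quadruple {2, q} xs" ..
  moreover have "odd q"
    using \<open>[q = 3] (mod 4)\<close> unfolding cong_def by presburger
  moreover have "\<not> QuadRes (int q) (- 1)"
    using assms by (rule not_QuadRes_minus_one_prime)
  ultimately have "two_prime_quadruple (int q) (int ` set xs)"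
    using \<open>prime q\<close> S_diophantine_quadruple_imp_two_prime_quadruple by blast
  then obtain x y z w e f g h i j k l
    where "power_quadruple 2 2 (int q) x y z w e f g h i j k l"
    by (rule two_prime_quadruple.obtain_power_quadruple)
  then show False
    using no_power_quadruple by blast
qed

end
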